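(* Let $G$ be a residually finite, finitely generated solvable group that is not virtually nilpotent, equipped with a finite generating subset $S$, and let $f:\mathbb{N}\to\mathbb{N}$ be a nondecreasing function such that $2^n \preceq f(n) \preceq 2^{2^n}$. Suppose that $G$ admits an infinite order, strictly $f$-distorted element $x$ contained in $\mathrm{Fitt}(G)$. Then $$\log(f(n)) \preceq \mathrm{RF}_{G}(n),$$ and if $x$ has nilpotent depth $m>1$, then $$(\log(f(n)))^{m+1} \preceq \mathrm{RF}_{G}(n).$$ In particular, $n \preceq \mathrm{RF}_G(n)$, and if $x$ has nilpotent depth $m>1$, then $n^{m+1} \preceq \mathrm{RF}_G(n)$.
   Context: $\mathbb{N}$ denotes the positive integers. For a finitely generated group $G$ with finite generating subset $S$, $\|x\|_S$ is the word length of $x$. For $x\in G\setminus\{1\}$ let $\mathrm{D}_G(x)=\min\{|H| : \varphi:G\to H \text{ a surjective homomorphism},\ |H|<\infty,\ \varphi(x)\ne 1\}$ (with value $\infty$ if there is no such $H$); $G$ is residually finite if $\mathrm{D}_G(x)<\infty$ for all $x \neq 1$. For residually finite $G$, $\mathrm{RF}_{G}(n)=\mathrm{RF}_{G,S}(n)=\max\{\mathrm{D}_G(x) : \|x\|_S\le n,\ x\ne 1\}$; changing $S$ does not change this function up to the equivalence $\approx$ below. For nondecreasing functions $f,g$ on $\mathbb{N}$ with nonnegative real values, $f\preceq g$ means that there is a constant $C>0$ (which may be taken to be an integer) with $f(n)\le C\,g(Cn)$ for all $n$; $f\approx g$ means $f\preceq g$ and $g\preceq f$. An infinite order element $x\in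 G$ is strictly $f$-distorted if there are constants $C_1,C_2>0$ with $C_1|n|\le f(\|x^n\|_S)\le C_2|n|$ for all integers $n>0$. $\gamma_m(N)$ is the $m$-th term of the lower central series, with $\gamma_1(N)=N$. $\mathrm{Fitt}(G)$, the Fitting subgroup, is the subgroup generated by all normal nilpotent subgroups of $G$. A nontrivial element $x\in\mathrm{Fitt}(G)$ has nilpotent depth $m$ if there is a normal nilpotent subgroup $N$ of $G$ such that $m$ is the largest natural number with $\langle x\rangle\cap\gamma_m(N)\ne\{1\}$. *)

theory Defs
  imports
    Complex_Main
    "HOL-Library.Extended_Nat"
    "HOL-Algebra.Solvable_Groups"
begin

section \<open>Growth comparison\<close>

text \<open>The positive integers are the elements \<open>n \<ge> 1\<close> of type \<^typ>\<open>nat\<close>; the value of a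
  function at \<open>0\<close> is irrelevant.\<close>

definition preceq :: "(nat \<Rightarrow> real) \<Rightarrow> (nat \<Rightarrow> real) \<Rightarrow> bool" (infix \<open>\<preceq>\<close> 50) where
  "f \<preceq> g \<longleftrightarrow> (\<exists>C::nat. C > 0 \<and> (\<forall>n\<ge>1. f n \<le> real C * g (C * n)))"

section \<open>Word length\<close>

definition word_length :: "('a, 'b) monoid_scheme \<Rightarrow> 'a set \<Rightarrow> 'a \<Rightarrow> nat" where
  "word_length G S x =
     (LEAST n. \<exists>ws. set ws \<subseteq> S \<union> m_inv G ` S \<and> length ws = n \<and> foldr (mult G) ws \<one>\<^bsub>G\<^esub> = x)"

section \<open>Residual finiteness growth\<close>

text \<open>Every finite group is isomorphic to one whose carrier is a set of natural numbers, so
  letting \<open>H\<close> range over groups on \<^typ>\<open>nat\<close> covers all finite quotients.  The infimum is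
  taken in \<^typ>\<open>enat\<close>: it is a minimum when such an \<open>H\<close> exists, and \<open>\<infinity>\<close> otherwise.\<close>

definition res_depth :: "('a, 'b) monoid_scheme \<Rightarrow> 'a \<Rightarrow> enat" where
  "res_depth G x =
     Inf {enat (order H) | (H :: nat monoid) \<phi>.
            group H \<and> finite (carrier H) \<and> \<phi> \<in> epi G H \<and> \<phi> x \<noteq> \<one>\<^bsub>H\<^esub>}"

definition residually_finite :: "('a, 'b) monoid_scheme \<Rightarrow> bool" where
  "residually_finite G \<longleftrightarrow> (\<forall>x \<in> carrier G - {\<one>\<^bsub>G\<^esub>}. res_depth G x < \<infinity>)"

text \<open>Meaningful when \<open>G\<close> is residually finite and nontrivial, \<open>S\<close> is a finite generating set and
  \<open>n \<ge> 1\<close>: then the maximum is over a finite nonempty set of finite values.\<close>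

definition RF :: "('a, 'b) monoid_scheme \<Rightarrow> 'a set \<Rightarrow> nat \<Rightarrow> nat" where
  "RF G S n =
     the_enat (Max (res_depth G ` {x \<in> carrier G - {\<one>\<^bsub>G\<^esub>}. word_length G S x \<le> n}))"

section \<open>Distortion\<close>

definition strictly_distorted ::
  "('a, 'b) monoid_scheme \<Rightarrow> 'a set \<Rightarrow> (nat \<Rightarrow> nat) \<Rightarrow> 'a \<Rightarrow> bool" where
  "strictly_distorted G S f x \<longleftrightarrow>
     (\<exists>C1 C2 :: real. C1 > 0 \<and> C2 > 0 \<and>
       (\<forall>n::nat. n > 0 \<longrightarrow>
          C1 * real n \<le> real (f (word_length G S (x [^]\<^bsub>G\<^esub> n))) \<and>
          real (f (word_length G S (x [^]\<^bsub>G\<^esub> n))) \<le> C2 * real n))"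

section \<open>Nilpotency\<close>

text \<open>As for \<^const>\<open>derived\<close>, the second argument is a subgroup of \<open>G\<close>, and commutators are
  computed in \<open>G\<close>.  Indexing starts at \<open>1\<close>; index \<open>0\<close> is a dummy.\<close>

fun lower_central :: "('a, 'b) monoid_scheme \<Rightarrow> 'a set \<Rightarrow> nat \<Rightarrow> 'a set" where
  "lower_central G N 0 = N"
| "lower_central G N (Suc 0) = N"
| "lower_central G N (Suc (Suc m)) =
     generate G (\<Union>a \<in> lower_central G N (Suc m). \<Union>b \<in> N.
       {a \<otimes>\<^bsub>G\<^esub> b \<otimes>\<^bsub>G\<^esub> inv\<^bsub>G\<^esub> a \<otimes>\<^bsub>G\<^esub> inv\<^bsub>G\<^esub> b})"

definition nilpotent_subgroup :: "('a, 'b) monoid_scheme \<Rightarrow> 'a set \<Rightarrow> bool" where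
  "nilpotent_subgroup G N \<longleftrightarrow>
     subgroup N G \<and> (\<exists>m\<ge>1. lower_central G N m = {\<one>\<^bsub>G\<^esub>})"

definition virtually_nilpotent :: "('a, 'b) monoid_scheme \<Rightarrow> bool" where
  "virtually_nilpotent G \<longleftrightarrow>
     (\<exists>N. nilpotent_subgroup G N \<and> finite (rcosets\<^bsub>G\<^esub> N))"

definition fitting :: "('a, 'b) monoid_scheme \<Rightarrow> 'a set" where
  "fitting G = generate G (\<Union>{N. N \<lhd> G \<and> nilpotent_subgroup G N})"

text \<open>A relation rather than a function of \<open>x\<close>, since \<open>m\<close> may depend on the choice of \<open>N\<close>.\<close>

definition has_nilpotent_depth :: "('a, 'b) monoid_scheme \<Rightarrow> 'a \<Rightarrow> nat \<Rightarrow> bool" where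
  "has_nilpotent_depth G x m \<longleftrightarrow>
     x \<in> fitting G \<and> x \<noteq> \<one>\<^bsub>G\<^esub> \<and>
     (\<exists>N. N \<lhd> G \<and> nilpotent_subgroup G N \<and>
        m \<ge> 1 \<and> generate G {x} \<inter> lower_central G N m \<noteq> {\<one>\<^bsub>G\<^esub>} \<and>
        (\<forall>k\<ge>1. generate G {x} \<inter> lower_central G N k \<noteq> {\<one>\<^bsub>G\<^esub>} \<longrightarrow> k \<le> m))"

end

theory Submission
  imports Defs "HOL-Algebra.Multiplicative_Group"
begin

text \<open>
  Let \<open>L = Lcm {1..k}\<close>, which is at most \<open>16 ^ k\<close> by Chebyshev's argument.  A finite quotient in
  which \<open>x ^ L\<close> survives contains an element whose order does not divide \<open>L\<close>, so it has more than
  \<open>k\<close> elements.  Since \<open>f\<close> of the length of \<open>x ^ L\<close> is of order \<open>L\<close>, one may take \<open>k\<close> proportional to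
  \<open>log (f n)\<close>.

  For depth \<open>m > 1\<close>, some power \<open>y\<close> of \<open>x\<close> with positive exponent lies in \<open>\<gamma>\<^sub>m(N)\<close>, where
  \<open>\<gamma>\<^sub>c(N) = 1\<close>.  The test element is now \<open>y ^ (L ^ c)\<close>: the exponent \<open>c\<close> guards against finite
  quotients in which \<open>y\<close> spreads over several terms of the lower central series.  If it survives in
  the finite image \<open>Q\<close> of \<open>N\<close>, then \<open>L\<close>-th powers of \<open>\<gamma>\<^sub>j(Q)\<close> do not all lie in \<open>\<gamma>\<^sub>j\<^sub>+\<^sub>1(Q)\<close> for some
  \<open>j \<ge> m\<close>.  As \<open>[u, v] ^ L\<close> and \<open>[u ^ L, v]\<close> agree modulo the next term, this descends to all
  \<open>i \<le> j\<close>, so every quotient \<open>\<gamma>\<^sub>i(Q) / \<gamma>\<^sub>i\<^sub>+\<^sub>1(Q)\<close> with \<open>i \<le> m\<close> has more than \<open>k\<close> elements; the first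
  one has at least \<open>(k + 1)\<^sup>2\<close>, because a commutator involves two independent elements.
\<close>

section \<open>An exponential bound for the least common multiple\<close>

lemma Lcm_atLeastAtMost_pos: "0 < (Lcm {1..n} :: nat)"
  by (auto simp: Lcm_0_iff intro: Nat.gr0I)

lemma times_binomial_dvd_Lcm:
  fixes n k :: nat
  assumes "1 \<le> k" "k \<le> n"
  shows "k * (n choose k) dvd Lcm {1..n}"
proof -
  \<comment> \<open>The numbers \<open>1 / (k * (n choose k))\<close> form Leibniz's harmonic triangle: each is a difference of
    two entries from the previous column, so \<open>Lcm {1..n}\<close> clears their denominators.\<close>
  have "\<forall>n\<ge>k. real (Lcm {1..n}) / real (k * (n choose k)) \<in> \<int>" using assms(1)
  proof (induction k rule: nat_induct_at_least)
    case base
    have "n dvd Lcm {1..n}" if "n \<ge> 1" for n :: nat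
      using that by (intro dvd_Lcm) auto
    then show ?case by (auto simp: real_of_nat_div[symmetric] simp del: of_nat_div)
  next
    case (Suc k)
    show ?case
    proof (intro allI impI)
      fix n :: nat assume "n \<ge> Suc k"
      then obtain n' where n: "n = Suc n'" and kn: "k \<le> n'" by (metis Suc_le_D Suc_le_mono)
      define c where "c = real (n' choose k)"
      have c: "c > 0" using kn by (simp add: c_def)
      \<comment> \<open>With \<open>c\<close> taken from the row above, the three entries have
        denominators \<open>n * c\<close>, \<open>k * c\<close> and
        \<open>k * n * c / (n - k)\<close>, so the triangle identity is one about fractions in
        \<open>n\<close> and \<open>k\<close>.\<close>
      have absorb: "real (Suc k * (n choose Suc k)) = real n * c"
        unfolding c_def n by (metis Suc_times_binomial of_nat_mult)
      have "(n - k) * (n choose k) = n * (n' choose k)"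
        using binomial_absorb_comp[of n k] n by simp
      then have "real (n - k) * real (n choose k) = real n * c"
        unfolding c_def by (metis of_nat_mult)
      then have comp: "real (n choose k) = real n * c / (real n - real k)"
        using kn n by (simp add: of_nat_diff field_simps)
      have leibniz: "1 / real (Suc k * (n choose Suc k))
          = 1 / real (k * (n' choose k)) - 1 / real (k * (n choose k))"
      proof -
        have "1 / (a * c) = 1 / (b * c) - 1 / (b * (a * c / (a - b)))"
          if "0 < b" "b < a" for a b :: real using that c by (simp add: field_simps)
        from this[of "real k" "real n"] show ?thesis
          unfolding absorb unfolding of_nat_mult comp c_def[symmetric] using Suc.hyps kn n by simp
      qed
      have "Lcm {1..n'} dvd (Lcm {1..n} :: nat)"
        unfolding n by (rule Lcm_subset) auto
      then obtain q where q: "Lcm {1..n} = Lcm {1..n'} * q" by (elim dvdE)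
      have "real (Lcm {1..n}) / real (k * (n' choose k)) \<in> \<int>"
        using Ints_mult[OF Suc.IH[rule_format, OF kn], of "real q"] unfolding q by simp
      moreover have "real (Lcm {1..n}) / real (k * (n choose k)) \<in> \<int>"
        using Suc.IH kn n by simp
      ultimately have "real (Lcm {1..n}) / real (k * (n' choose k))
          - real (Lcm {1..n}) / real (k * (n choose k)) \<in> \<int>" by (rule Ints_diff)
      also have "real (Lcm {1..n}) / real (k * (n' choose k))
          - real (Lcm {1..n}) / real (k * (n choose k))
          = real (Lcm {1..n}) * (1 / real (k * (n' choose k)) - 1 / real (k * (n choose k)))"
        by (simp only: right_diff_distrib times_divide_eq_right mult_1_right)
      also have "\<dots> = real (Lcm {1..n}) / real (Suc k * (n choose Suc k))"
        unfolding leibniz[symmetric] by simp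
      finally show "real (Lcm {1..n}) / real (Suc k * (n choose Suc k)) \<in> \<int>" .
    qed
  qed
  then have "real (Lcm {1..n}) / real (k * (n choose k)) \<in> \<int>" using assms by blast
  then obtain z where z: "real (Lcm {1..n}) / real (k * (n choose k)) = of_int z"
    by (elim Ints_cases)
  have pos: "k * (n choose k) > 0" using assms by simp
  have "of_int (int (Lcm {1..n})) = real_of_int (int (k * (n choose k)) * z)"
    using z pos by (simp add: field_simps)
  then have "int (Lcm {1..n}) = int (k * (n choose k)) * z" by (rule of_int_eq_iff[THEN iffD1])
  then show ?thesis by (metis dvd_triv_left int_dvd_int_iff)
qed

text \<open>A \<open>d \<le> n\<close> divides the first factor. For \<open>d = n + r\<close>,
  counting nested subsets gives \<open>(2 * n choose n) * (n choose r) = (2 * n choose d) * (d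
  choose r)\<close>, and \<open>r * (d choose r)\<close> is a multiple of \<open>d\<close>. The
  factor \<open>r * (n choose r)\<close> that this needs already divides
  \<open>Lcm {1..n}\<close>.\<close>

lemma Lcm_double_dvd: "Lcm {1..2 * n} dvd (Lcm {1..n} * (2 * n choose n) :: nat)"
proof (rule Lcm_least)
  fix d assume d: "d \<in> {1..2 * n}"
  show "d dvd Lcm {1..n} * (2 * n choose n)"
  proof (cases "d \<le> n")
    case True
    then show ?thesis using d by (intro dvd_mult2 dvd_Lcm) auto
  next
    case False
    define r where "r = d - n"
    have r: "1 \<le> r" "r \<le> n" "d = n + r" using d False by (auto simp: r_def)
    have "(2 * n choose n) * (n choose r) = (2 * n choose d) * (d choose r)"
      using choose_mult[of r d "2 * n"] choose_mult[of r n "2 * n"]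
        binomial_symmetric[of n "2 * n - r"] r by (simp add: algebra_simps)
    moreover have "r * (d choose r) = d * ((d - 1) choose (r - 1))"
      using r by (intro times_binomial_minus1_eq) simp
    ultimately have "r * (n choose r) * (2 * n choose n)
        = d * (((d - 1) choose (r - 1)) * (2 * n choose d))"
      by (metis mult.assoc mult.commute)
    then have "d dvd r * (n choose r) * (2 * n choose n)" by simp
    also have "\<dots> dvd Lcm {1..n} * (2 * n choose n)"
      using times_binomial_dvd_Lcm r by (intro mult_dvd_mono) auto
    finally show ?thesis .
  qed
qed

text \<open>Each doubling along powers of two costs a central binomial coefficient, which is at most
  \<open>4 ^ (2 ^ j)\<close>. Rounding \<open>n\<close> up to a power of two, at most
  \<open>2 * n\<close>, turns the base 4 into 16.\<close>

lemma Lcm_le_power: "(Lcm {1..n} :: nat) \<le> 16 ^ n"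
proof -
  have pow: "(Lcm {1..2 ^ j} :: nat) \<le> 4 ^ (2 ^ j)" for j :: nat
  proof (induction j)
    case (Suc j)
    have "(Lcm {1..2 * 2 ^ j} :: nat) \<le> Lcm {1..2 ^ j} * (2 * 2 ^ j choose 2 ^ j)"
      using Lcm_double_dvd[of "2 ^ j"] Lcm_atLeastAtMost_pos[of "2 ^ j"]
      by (intro dvd_imp_le) (auto simp: mult_2)
    also have "\<dots> \<le> 4 ^ (2 ^ j) * 2 ^ (2 * 2 ^ j)"
      by (intro mult_mono Suc.IH binomial_le_pow2) auto
    also have "\<dots> = 4 ^ (2 ^ j) * (2 ^ 2) ^ (2 ^ j)" by (simp only: power_mult)
    also have "\<dots> = 4 ^ (2 ^ Suc j)"
      by (simp add: mult_2 power_add)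
    finally show ?case by simp
  qed simp
  show ?thesis
  proof (cases "n = 0")
    case False
    then obtain j where j: "2 ^ j \<le> n" "n < 2 ^ (j + 1)"
      using ex_power_ivl1[of 2 n] by auto
    have "Lcm {1..n} dvd (Lcm {1..2 ^ Suc j} :: nat)"
      using j by (intro Lcm_subset) auto
    then have "(Lcm {1..n} :: nat) \<le> Lcm {1..2 ^ Suc j}"
      by (intro dvd_imp_le Lcm_atLeastAtMost_pos)
    also have "\<dots> \<le> 4 ^ (2 ^ Suc j)" by (rule pow)
    also have "\<dots> \<le> 4 ^ (2 * n)" using j by (intro power_increasing) auto
    also have "\<dots> = 16 ^ n" by (simp add: power_mult)
    finally show ?thesis .
  qed simp
qed

section \<open>The lower central series of a finite group\<close>

abbreviation (in group) commutator :: "'a \<Rightarrow> 'a \<Rightarrow> 'a"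
  where "commutator a b \<equiv> a \<otimes> b \<otimes> inv a \<otimes> inv b"

lemma (in group) mult_eq_commutator_mult:
  assumes "a \<in> carrier G" "b \<in> carrier G"
  shows "a \<otimes> b = commutator a b \<otimes> b \<otimes> a"
  using assms by (simp add: m_assoc)

lemma (in group_hom) hom_commutator_eq_one_iff:
  assumes "a \<in> carrier G" "b \<in> carrier G"
  shows "h (G.commutator a b) = \<one>\<^bsub>H\<^esub> \<longleftrightarrow> h a \<otimes>\<^bsub>H\<^esub> h b = h b \<otimes>\<^bsub>H\<^esub> h a"
proof -
  define c where "c = G.commutator a b"
  have c: "c \<in> carrier G" unfolding c_def using assms by simp
  have "a \<otimes> b = c \<otimes> b \<otimes> a"
    unfolding c_def using assms by (rule G.mult_eq_commutator_mult)
  then have "h a \<otimes>\<^bsub>H\<^esub> h b = h c \<otimes>\<^bsub>H\<^esub> (h b \<otimes>\<^bsub>H\<^esub> h a)"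
    using assms c by (metis hom_mult G.m_closed G.m_assoc)
  then show ?thesis unfolding c_def[symmetric] using assms c by simp
qed

text \<open>This set is the preimage under \<open>h\<close> of the centraliser of
  \<open>h a\<close>. With \<open>h\<close> a quotient map it yields the subgroup \<open>K\<close>
  of the order bound below.\<close>

lemma (in group_hom) subgroup_commuting_image:
  assumes "a \<in> carrier G"
  shows "subgroup {g \<in> carrier G. h a \<otimes>\<^bsub>H\<^esub> h g = h g \<otimes>\<^bsub>H\<^esub> h a} G"
proof
  fix g g' assume "g \<in> {g \<in> carrier G. h a \<otimes>\<^bsub>H\<^esub> h g = h g \<otimes>\<^bsub>H\<^esub> h a}"
    "g' \<in> {g \<in> carrier G. h a \<otimes>\<^bsub>H\<^esub> h g = h g \<otimes>\<^bsub>H\<^esub> h a}"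
  then show "g \<otimes> g' \<in> {g \<in> carrier G. h a \<otimes>\<^bsub>H\<^esub> h g = h g \<otimes>\<^bsub>H\<^esub> h a}"
    using assms by simp (metis H.m_assoc hom_closed)
next
  fix g assume "g \<in> {g \<in> carrier G. h a \<otimes>\<^bsub>H\<^esub> h g = h g \<otimes>\<^bsub>H\<^esub> h a}"
  then have g: "g \<in> carrier G" "h a \<otimes>\<^bsub>H\<^esub> h g = h g \<otimes>\<^bsub>H\<^esub> h a" by auto
  have "h g \<otimes>\<^bsub>H\<^esub> (h a \<otimes>\<^bsub>H\<^esub> inv\<^bsub>H\<^esub> h g) = h a \<otimes>\<^bsub>H\<^esub> h g \<otimes>\<^bsub>H\<^esub> inv\<^bsub>H\<^esub> h g"
    unfolding g(2) using assms g(1) by (simp only: H.m_assoc hom_closed H.inv_closed)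
  also have "\<dots> = h a" using assms g(1) by (simp add: H.m_assoc)
  finally have "h a \<otimes>\<^bsub>H\<^esub> inv\<^bsub>H\<^esub> h g = inv\<^bsub>H\<^esub> h g \<otimes>\<^bsub>H\<^esub> h a"
    using assms g(1) by (simp add: H.inv_solve_left)
  then show "inv g \<in> {g \<in> carrier G. h a \<otimes>\<^bsub>H\<^esub> h g = h g \<otimes>\<^bsub>H\<^esub> h a}" using g by simp
qed (use assms in auto)

text \<open>Each \<open>u\<close> that passes \<open>v\<close> leaves a factor \<open>c\<close>; as
  \<open>c\<close> commutes with \<open>u\<close>, these factors can be collected in front.\<close>

lemma (in group) pow_mult_of_commutator_left:
  assumes "u \<in> carrier G" "v \<in> carrier G" "c \<in> carrier G"
    and "u \<otimes> v = c \<otimes> v \<otimes> u" "u \<otimes> c = c \<otimes> u"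
  shows "u [^] (n::nat) \<otimes> v = c [^] n \<otimes> v \<otimes> u [^] n"
proof (induction n)
  case (Suc n)
  have "u [^] n \<otimes> c = c \<otimes> u [^] n"
    using assms by (metis group_commutes_pow)
  have "u [^] Suc n \<otimes> v = u [^] n \<otimes> c \<otimes> v \<otimes> u"
    using assms by (simp add: m_assoc)
  also have "\<dots> = c \<otimes> (u [^] n \<otimes> v) \<otimes> u"
    using assms by (simp add: \<open>u [^] n \<otimes> c = c \<otimes> u [^] n\<close> m_assoc)
  also have "\<dots> = (c \<otimes> c [^] n) \<otimes> v \<otimes> u [^] Suc n"
    unfolding Suc.IH using assms by (simp add: m_assoc)
  also have "c \<otimes> c [^] n = c [^] Suc n" using assms nat_pow_Suc2 by simp
  finally show ?case .
qed (use assms in simp)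

text \<open>The mirror image: now \<open>c\<close> has to pass copies of \<open>v\<close>.\<close>

lemma (in group) mult_pow_of_commutator_right:
  assumes "u \<in> carrier G" "v \<in> carrier G" "c \<in> carrier G"
    and "u \<otimes> v = c \<otimes> v \<otimes> u" "v \<otimes> c = c \<otimes> v"
  shows "u \<otimes> v [^] (n::nat) = c [^] n \<otimes> v [^] n \<otimes> u"
proof (induction n)
  case (Suc n)
  have "v [^] n \<otimes> c = c \<otimes> v [^] n"
    using assms by (metis group_commutes_pow)
  have "u \<otimes> v [^] Suc n = c [^] n \<otimes> v [^] n \<otimes> (u \<otimes> v)"
    using assms Suc.IH m_assoc[of u "v [^] n" v] m_assoc[of "c [^] n \<otimes> v [^] n" u v] by simp
  also have "\<dots> = c [^] n \<otimes> (v [^] n \<otimes> c) \<otimes> v \<otimes> u"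
    using assms by (simp add: m_assoc)
  also have "\<dots> = c [^] Suc n \<otimes> v [^] Suc n \<otimes> u"
    unfolding \<open>v [^] n \<otimes> c = c \<otimes> v [^] n\<close> using assms by (simp add: m_assoc)
  finally show ?case .
qed (use assms in simp)

lemma (in normal) hom_Mod: "group_hom G (G Mod H) (\<lambda>a. H #> a)"
  using r_coset_hom_Mod factorgroup_is_group
  by (simp add: group_hom_def group_hom_axioms_def is_group)

lemma (in normal) coset_eq_one_iff:
  assumes "a \<in> carrier G"
  shows "H #> a = \<one>\<^bsub>G Mod H\<^esub> \<longleftrightarrow> a \<in> H"
  using assms coset_join1 coset_join2 subgroup_axioms subset
  by (metis one_FactGroup rcos_const is_group)

lemma (in group) commutator_mem_normal_iff:
  assumes "R \<lhd> G" "a \<in> carrier G" "b \<in> carrier G"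
  shows "commutator a b \<in> R \<longleftrightarrow> (R #> a) \<otimes>\<^bsub>G Mod R\<^esub> (R #> b) = (R #> b) \<otimes>\<^bsub>G Mod R\<^esub> (R #> a)"
  using normal.coset_eq_one_iff[OF assms(1)] assms
    group_hom.hom_commutator_eq_one_iff[OF normal.hom_Mod[OF assms(1)]] by simp

lemma (in group) commutator_mem_normal_sym:
  assumes "R \<lhd> G" "a \<in> carrier G" "b \<in> carrier G"
  shows "commutator a b \<in> R \<longleftrightarrow> commutator b a \<in> R"
  using assms by (auto simp: commutator_mem_normal_iff)

text \<open>In the image \<open>[u, v]\<close> commutes with \<open>u\<close>, so
  \<open>[u, v] ^ n = [u ^ n, v]\<close> there, and the right-hand side is trivial.\<close>

lemma (in group_hom) commutator_pow_left_kernel: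
  assumes "u \<in> carrier G" "v \<in> carrier G"
    and c: "h (G.commutator (G.commutator u v) u) = \<one>\<^bsub>H\<^esub>"
    and un: "h (G.commutator (u [^] (n::nat)) v) = \<one>\<^bsub>H\<^esub>"
  shows "h (G.commutator u v [^] n) = \<one>\<^bsub>H\<^esub>"
proof -
  define c where "c = G.commutator u v"
  have cc: "c \<in> carrier G" unfolding c_def using assms by simp
  have uv: "u \<otimes> v = c \<otimes> v \<otimes> u"
    unfolding c_def using assms by (intro G.mult_eq_commutator_mult)
  then have "h u \<otimes>\<^bsub>H\<^esub> h v = h c \<otimes>\<^bsub>H\<^esub> h v \<otimes>\<^bsub>H\<^esub> h u"
    using assms(1,2) cc by (metis hom_mult G.m_closed)
  moreover have "h u \<otimes>\<^bsub>H\<^esub> h c = h c \<otimes>\<^bsub>H\<^esub> h u"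
    using c hom_commutator_eq_one_iff[OF cc assms(1)] unfolding c_def by simp
  ultimately have "h u [^]\<^bsub>H\<^esub> n \<otimes>\<^bsub>H\<^esub> h v
      = h c [^]\<^bsub>H\<^esub> n \<otimes>\<^bsub>H\<^esub> h v \<otimes>\<^bsub>H\<^esub> h u [^]\<^bsub>H\<^esub> n"
    using assms(1,2) cc by (intro H.pow_mult_of_commutator_left) auto
  moreover have "h u [^]\<^bsub>H\<^esub> n \<otimes>\<^bsub>H\<^esub> h v = h v \<otimes>\<^bsub>H\<^esub> h u [^]\<^bsub>H\<^esub> n"
    using un hom_commutator_eq_one_iff[of "u [^] n" v] assms(1,2) by (simp add: hom_nat_pow)
  ultimately show ?thesis
    unfolding c_def[symmetric] using assms(1,2) cc
    by (simp add: hom_nat_pow H.m_assoc)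
qed

text \<open>The same with \<open>[u, v] ^ n = [u, v ^ n]\<close>, which holds in the image because
  \<open>[u, v]\<close> commutes with \<open>v\<close> there.\<close>

lemma (in group_hom) commutator_pow_right_kernel:
  assumes "u \<in> carrier G" "v \<in> carrier G"
    and c: "h (G.commutator (G.commutator u v) v) = \<one>\<^bsub>H\<^esub>"
    and vn: "h (G.commutator u (v [^] (n::nat))) = \<one>\<^bsub>H\<^esub>"
  shows "h (G.commutator u v [^] n) = \<one>\<^bsub>H\<^esub>"
proof -
  define c where "c = G.commutator u v"
  have cc: "c \<in> carrier G" unfolding c_def using assms by simp
  have uv: "u \<otimes> v = c \<otimes> v \<otimes> u"
    unfolding c_def using assms by (intro G.mult_eq_commutator_mult)
  then have "h u \<otimes>\<^bsub>H\<^esub> h v = h c \<otimes>\<^bsub>H\<^esub> h v \<otimes>\<^bsub>H\<^esub> h u"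
    using assms(1,2) cc by (metis hom_mult G.m_closed)
  moreover have "h v \<otimes>\<^bsub>H\<^esub> h c = h c \<otimes>\<^bsub>H\<^esub> h v"
    using c hom_commutator_eq_one_iff[OF cc assms(2)] unfolding c_def by simp
  ultimately have "h u \<otimes>\<^bsub>H\<^esub> h v [^]\<^bsub>H\<^esub> n
      = h c [^]\<^bsub>H\<^esub> n \<otimes>\<^bsub>H\<^esub> h v [^]\<^bsub>H\<^esub> n \<otimes>\<^bsub>H\<^esub> h u"
    using assms(1,2) cc by (intro H.mult_pow_of_commutator_right) auto
  moreover have "h u \<otimes>\<^bsub>H\<^esub> h v [^]\<^bsub>H\<^esub> n = h v [^]\<^bsub>H\<^esub> n \<otimes>\<^bsub>H\<^esub> h u"
    using vn hom_commutator_eq_one_iff[of u "v [^] n"] assms(1,2) by (simp add: hom_nat_pow)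
  ultimately show ?thesis
    unfolding c_def[symmetric] using assms(1,2) cc
    by (simp add: hom_nat_pow H.m_assoc)
qed

lemma (in group) commutator_pow_mem_left:
  assumes "R \<lhd> G" "u \<in> carrier G" "v \<in> carrier G"
    and "commutator (commutator u v) u \<in> R" "commutator (u [^] (n::nat)) v \<in> R"
  shows "commutator u v [^] n \<in> R"
  using group_hom.commutator_pow_left_kernel[OF normal.hom_Mod[OF assms(1)] assms(2,3), of n]
    assms normal.coset_eq_one_iff[OF assms(1)] by simp

lemma (in group) commutator_pow_mem_right:
  assumes "R \<lhd> G" "u \<in> carrier G" "v \<in> carrier G"
    and "commutator (commutator u v) v \<in> R" "commutator u (v [^] (n::nat)) \<in> R"
  shows "commutator u v [^] n \<in> R"
  using group_hom.commutator_pow_right_kernel[OF normal.hom_Mod[OF assms(1)] assms(2,3), of n]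
    assms normal.coset_eq_one_iff[OF assms(1)] by simp

section \<open>Powers along the lower central series\<close>

abbreviation (in group) lcs :: "nat \<Rightarrow> 'a set"
  where "lcs \<equiv> lower_central G (carrier G)"

text \<open>The inclusion at one step gives normality of the next term: for \<open>a\<close> in
  \<open>B \<subseteq> A\<close>, the conjugate of \<open>a\<close> by \<open>b\<close> is
  \<open>a\<close> times the commutator of \<open>inv a\<close> and \<open>b\<close>, and both
  factors lie in \<open>B\<close>.\<close>

lemma (in group) lcs_normal_Suc_subset:
  "lcs (Suc i) \<lhd> G \<and> lcs (Suc (Suc i)) \<subseteq> lcs (Suc i)"
proof (induction i)
  case 0
  have "carrier G \<lhd> G" by (intro normal_invI subgroup_self) auto
  moreover have "generate G (\<Union>a\<in>carrier G. \<Union>b\<in>carrier G. {commutator a b}) \<subseteq> carrier G"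
    by (intro generate_incl) auto
  ultimately show ?case by simp
next
  case (Suc i)
  define A where "A = lcs (Suc i)"
  define B where "B = lcs (Suc (Suc i))"
  interpret A: normal A G using Suc A_def by simp
  have BA: "B \<subseteq> A" using Suc A_def B_def by simp
  have B: "B = generate G (\<Union>a\<in>A. \<Union>b\<in>carrier G. {commutator a b})"
    unfolding A_def B_def by simp
  have comm: "commutator a b \<in> B" if "a \<in> A" "b \<in> carrier G" for a b
    unfolding B using that by (intro generate.incl) auto
  interpret B: subgroup B G
    unfolding B using A.subset by (intro generate_is_subgroup) auto
  have conj: "b \<otimes> a \<otimes> inv b \<in> B" if a: "a \<in> B" and b: "b \<in> carrier G" for a b
  proof -
    have "a \<in> carrier G" using a B.subset by blast
    have "commutator (inv a) b \<in> B" using comm[of "inv a" b] a b BA by blast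
    then have "a \<otimes> commutator (inv a) b \<in> B" by (rule B.m_closed[OF a])
    also have "a \<otimes> commutator (inv a) b = b \<otimes> a \<otimes> inv b"
      using b \<open>a \<in> carrier G\<close> by (simp add: m_assoc[symmetric])
    finally show ?thesis .
  qed
  then have normal: "B \<lhd> G" by (intro normal_invI B.subgroup_axioms) auto
  have "commutator a b \<in> B" if a: "a \<in> B" and b: "b \<in> carrier G" for a b
    using comm a b BA by blast
  then have "generate G (\<Union>a\<in>B. \<Union>b\<in>carrier G. {commutator a b}) \<subseteq> B"
    by (intro generate_subgroup_incl B.subgroup_axioms) auto
  then show ?case using normal unfolding B_def by simp
qed

lemma (in group) lcs_normal: "lcs (Suc i) \<lhd> G"
  using lcs_normal_Suc_subset by blast

lemma (in group) lcs_subset: "lcs i \<subseteq> carrier G"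
  using normal.axioms(1)[OF lcs_normal] subgroup.subset by (cases i) auto

lemma (in group) lcs_antimono: "i \<le> j \<Longrightarrow> lcs (Suc j) \<subseteq> lcs (Suc i)"
  by (induction rule: dec_induct) (use lcs_normal_Suc_subset in blast)+

lemma (in group) commutator_mem_lcs:
  "a \<in> lcs (Suc i) \<Longrightarrow> b \<in> carrier G \<Longrightarrow> commutator a b \<in> lcs (Suc (Suc i))"
  by (auto intro: generate.incl)

text \<open>Elements of a term commute with each other modulo the next term, so taking
  \<open>n\<close>-th powers is multiplicative there and it is enough to look at generators.\<close>

lemma (in group) lcs_pow_mem_of_commutators:
  assumes gen: "\<And>u v. \<lbrakk>u \<in> lcs (Suc i); v \<in> carrier G\<rbrakk>
      \<Longrightarrow> commutator u v [^] (n::nat) \<in> lcs (Suc (Suc (Suc i)))"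
    and z: "z \<in> lcs (Suc (Suc i))"
  shows "z [^] n \<in> lcs (Suc (Suc (Suc i)))"
proof -
  define R where "R = lcs (Suc (Suc (Suc i)))"
  have R: "R \<lhd> G" unfolding R_def by (rule lcs_normal)
  interpret R: normal R G by (rule R)
  interpret \<pi>: group_hom G "G Mod R" "\<lambda>a. R #> a" by (rule normal.hom_Mod[OF R])
  have sub: "lcs (Suc (Suc i)) \<subseteq> carrier G" by (rule lcs_subset)
  have "z [^] n \<in> R" using z unfolding lower_central.simps
  proof (induction z rule: generate.induct)
    case (incl h)
    then show ?case using gen unfolding R_def by blast
  next
    case (inv h)
    then obtain u v where h: "h = commutator u v" "u \<in> lcs (Suc i)" "v \<in> carrier G" by auto
    then have "h \<in> carrier G" using lcs_subset by blast
    moreover have "h [^] n \<in> R" using gen h unfolding R_def by blast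
    ultimately show ?case by (simp add: nat_pow_inv)
  next
    case (eng h1 h2)
    then have h: "h1 \<in> lcs (Suc (Suc i))" "h2 \<in> lcs (Suc (Suc i))" by simp_all
    then have hc: "h1 \<in> carrier G" "h2 \<in> carrier G" using sub by auto
    have "commutator h1 h2 \<in> R"
      unfolding R_def by (rule commutator_mem_lcs[OF h(1) hc(2)])
    then have "(R #> h1) \<otimes>\<^bsub>G Mod R\<^esub> (R #> h2) = (R #> h2) \<otimes>\<^bsub>G Mod R\<^esub> (R #> h1)"
      by (rule commutator_mem_normal_iff[OF R hc, THEN iffD1])
    then have "((R #> h1) \<otimes>\<^bsub>G Mod R\<^esub> (R #> h2)) [^]\<^bsub>G Mod R\<^esub> n
        = (R #> h1) [^]\<^bsub>G Mod R\<^esub> n \<otimes>\<^bsub>G Mod R\<^esub> (R #> h2) [^]\<^bsub>G Mod R\<^esub> n"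
      using hc by (intro \<pi>.H.pow_mult_distrib) auto
    also have "\<dots> = (R #> (h1 [^] n)) \<otimes>\<^bsub>G Mod R\<^esub> (R #> (h2 [^] n))"
      using hc by (simp add: \<pi>.hom_nat_pow)
    also have "\<dots> = \<one>\<^bsub>G Mod R\<^esub>"
      using eng.IH hc R.coset_eq_one_iff[of "h1 [^] n"] R.coset_eq_one_iff[of "h2 [^] n"]
      by (simp del: mult_FactGroup one_FactGroup)
    finally have "R #> ((h1 \<otimes> h2) [^] n) = \<one>\<^bsub>G Mod R\<^esub>"
      using hc by (simp add: \<pi>.hom_nat_pow)
    then show ?case using hc R.coset_eq_one_iff by simp
  qed simp
  then show ?thesis unfolding R_def .
qed

text \<open>Modulo the term after next, \<open>[u, v] ^ n\<close> agrees with
  \<open>[u ^ n, v]\<close>, and \<open>u ^ n\<close> already lies one term further down. Read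
  contrapositively, a failure at a late term forces a failure at each earlier one.\<close>

lemma (in group) lcs_pow_mem_Suc:
  assumes pow: "\<And>z. z \<in> lcs (Suc i) \<Longrightarrow> z [^] (n::nat) \<in> lcs (Suc (Suc i))"
    and z: "z \<in> lcs (Suc (Suc i))"
  shows "z [^] n \<in> lcs (Suc (Suc (Suc i)))"
proof (rule lcs_pow_mem_of_commutators[OF _ z])
  fix u v assume u: "u \<in> lcs (Suc i)" and v: "v \<in> carrier G"
  have uc: "u \<in> carrier G" using u lcs_subset by blast
  show "commutator u v [^] n \<in> lcs (Suc (Suc (Suc i)))"
    using u v uc pow
    by (intro commutator_pow_mem_left commutator_mem_lcs lcs_normal)
qed

section \<open>Coset counts and the order of a finite nilpotent group\<close>

lemma (in group) subgroup_nat_pow_closed: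
  assumes "subgroup A G" "a \<in> A"
  shows "a [^] (n::nat) \<in> A"
  using subgroup_int_pow_closed[OF assms, of "int n"] by (simp add: int_pow_int)

text \<open>The cosets of \<open>B\<close> by \<open>z [^] i\<close> for \<open>i \<le> k\<close>
  are disjoint: otherwise \<open>z [^] (j - i) \<in> B\<close> with
  \<open>1 \<le> j - i \<le> k\<close>, and since \<open>j - i\<close> divides \<open>L\<close>,
  also \<open>z [^] L \<in> B\<close>.\<close>

lemma (in group) card_subgroup_ge:
  assumes "subgroup A G" "subgroup B G" "B \<subseteq> A" "finite A"
    and z: "z \<in> A" "z [^] (L::nat) \<notin> B" and dvd: "\<And>d. 1 \<le> d \<Longrightarrow> d \<le> k \<Longrightarrow> d dvd L"
  shows "(k + 1) * card B \<le> card A"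
proof -
  interpret A: subgroup A G by fact
  interpret B: subgroup B G by fact
  have zc: "z \<in> carrier G" using z by simp
  have disj: False if ij: "i < j" "j \<le> k" and b: "b \<in> B" "b' \<in> B"
    and eq: "z [^] i \<otimes> b = z [^] j \<otimes> b'" for i j b b'
  proof -
    have "z [^] i \<otimes> b = z [^] i \<otimes> (z [^] (j - i) \<otimes> b')"
      using eq ij b zc nat_pow_mult[of z i "j - i"] by (simp add: m_assoc[symmetric])
    then have "b = z [^] (j - i) \<otimes> b'" using b zc by simp
    then have "z [^] (j - i) = b \<otimes> inv b'" using b zc by (simp add: m_assoc)
    then have "z [^] (j - i) \<in> B" using b by simp
    moreover obtain q where "L = (j - i) * q" using dvd[of "j - i"] ij by (force elim: dvdE)
    ultimately have "z [^] L \<in> B"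
      using nat_pow_pow[OF zc, of "j - i" q] subgroup_nat_pow_closed[OF assms(2)] by metis
    then show False using z by simp
  qed
  have "inj_on (\<lambda>(i, b). z [^] i \<otimes> b) ({..k} \<times> B)"
  proof (rule inj_onI, clarify)
    fix i b j b' assume *: "i \<le> k" "j \<le> k" "b \<in> B" "b' \<in> B" "z [^] i \<otimes> b = z [^] j \<otimes> b'"
    then have "i = j" using disj[of i j b b'] disj[of j i b' b] by (metis linorder_neqE_nat)
    then show "i = j \<and> b = b'" using * zc by simp
  qed
  moreover have "(\<lambda>(i, b). z [^] i \<otimes> b) ` ({..k} \<times> B) \<subseteq> A"
    using z assms(3) subgroup_nat_pow_closed[OF assms(1)] by auto
  ultimately have "card ({..k} \<times> B) \<le> card A"
    using assms(4) card_inj_on_le by blast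
  then show ?thesis by (simp add: card_cartesian_product)
qed

text \<open>The exponent is \<open>(m - 1) + 2\<close>: one factor \<open>k + 1\<close> for each
  step from \<open>lcs 2\<close> down to \<open>lcs (m + 1)\<close>, and two factors between
  \<open>lcs 2\<close> and the whole group.\<close>

lemma (in group) order_ge_of_lcs:
  assumes fin: "finite (carrier G)"
    and m: "2 \<le> m" "y \<in> lcs m" and c: "1 \<le> c" "lcs c = {\<one>}" and y: "y [^] (L ^ c :: nat) \<noteq> \<one>"
    and dvd: "\<And>d. 1 \<le> d \<Longrightarrow> d \<le> k \<Longrightarrow> d dvd L"
  shows "(k + 1) ^ (m + 1) \<le> order G"
proof -
  have sub: "subgroup (lcs (Suc i)) G" for i using lcs_normal normal.axioms(1) by blast
  have fin': "finite (lcs i)" for i using fin lcs_subset finite_subset by blast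
  have yc: "y \<in> carrier G" using m lcs_subset by blast
  \<comment> \<open>Otherwise taking \<open>L\<close>-th powers moves down the series from \<open>Suc i\<close> on, and kills \<open>y\<close> in \<open>c\<close> steps.\<close>
  have drop: "\<not> (\<forall>z\<in>lcs (Suc i). z [^] L \<in> lcs (Suc (Suc i)))" if "Suc i \<le> m" for i
  proof
    assume "\<forall>z\<in>lcs (Suc i). z [^] L \<in> lcs (Suc (Suc i))"
    then have pow: "\<forall>z\<in>lcs (Suc (i + j)). z [^] L \<in> lcs (Suc (Suc (i + j)))" for j
      by (induction j) (simp_all only: add_0_right add_Suc_right, blast intro: lcs_pow_mem_Suc)
    have "y [^] (L ^ t) \<in> lcs (m + t)" for t
    proof (induction t)
      case (Suc t)
      have "y [^] (L ^ Suc t) = (y [^] (L ^ t)) [^] L"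
        using yc by (simp add: nat_pow_pow mult.commute)
      moreover have "m + t = Suc (i + (m + t - Suc i))" using that by simp
      ultimately show ?case using pow[of "m + t - Suc i"] Suc.IH by (metis add_Suc_right)
    qed (use m yc in simp)
    then have "y [^] (L ^ c) \<in> lcs (m + c)" .
    also have "lcs (m + c) \<subseteq> lcs c"
      using lcs_antimono[of "c - 1" "m + c - 1"] c m by simp
    finally show False using y c by simp
  qed
  have chain: "(k + 1) ^ t * card (lcs (t + 2)) \<le> card (lcs 2)" if "t + 1 \<le> m" for t
    using that
  proof (induction t)
    case (Suc t)
    obtain z where "z \<in> lcs (Suc (Suc t))" "z [^] L \<notin> lcs (Suc (Suc (Suc t)))"
      using drop[of "Suc t"] Suc.prems by auto
    then have "(k + 1) * card (lcs (Suc (Suc (Suc t)))) \<le> card (lcs (Suc (Suc t)))"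
      using lcs_normal_Suc_subset[of "Suc t"] dvd
      by (intro card_subgroup_ge[of _ _ z L] sub fin') (auto simp del: lower_central.simps)
    then have "(k + 1) ^ t * ((k + 1) * card (lcs (Suc t + 2))) \<le> (k + 1) ^ t * card (lcs (t + 2))"
      by simp
    also have "\<dots> \<le> card (lcs 2)" using Suc by simp
    finally show ?case by (simp only: power_Suc mult_ac)
  qed (simp add: numeral_2_eq_2 del: lower_central.simps)
  \<comment> \<open>Some element of \<open>lcs 2\<close> has its \<open>L\<close>-th power outside
    \<open>lcs 3\<close>, by \<open>drop\<close> at index 2, which is where \<open>2 \<le> m\<close>
    enters. Hence the same is true of one of the generating commutators.\<close>
  obtain a b where ab: "a \<in> carrier G" "b \<in> carrier G"
    "commutator a b [^] L \<notin> lcs (Suc (Suc (Suc 0)))"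
  proof -
    have "lcs (Suc 0) = carrier G" by (rule lower_central.simps(2))
    then have "\<exists>a\<in>carrier G. \<exists>b\<in>carrier G. commutator a b [^] L \<notin> lcs (Suc (Suc (Suc 0)))"
      using drop[of "Suc 0"] m(1) lcs_pow_mem_of_commutators[of 0 L] by (metis numeral_2_eq_2)
    then show thesis using that by blast
  qed
  define R where "R = lcs (Suc (Suc (Suc 0)))"
  have R: "R \<lhd> G" unfolding R_def by (rule lcs_normal)
  \<comment> \<open>\<open>K\<close> is the kernel of \<open>g \<mapsto> [a, g]\<close> modulo \<open>R\<close>; it lies between \<open>lcs 2\<close> and the whole group,
    which gives the first quotient of the series two factors \<open>k + 1\<close> instead of one.\<close>
  define K where "K = {g \<in> carrier G. commutator a g \<in> R}"
  have subK: "subgroup K G"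
    using group_hom.subgroup_commuting_image[OF normal.hom_Mod[OF R] ab(1)]
      commutator_mem_normal_iff[OF R ab(1)]
    unfolding K_def by (simp cong: conj_cong del: mult_FactGroup)
  have K2: "lcs (Suc (Suc 0)) \<subseteq> K"
  proof
    fix g assume g: "g \<in> lcs (Suc (Suc 0))"
    then have "g \<in> carrier G" using lcs_subset by blast
    with commutator_mem_lcs[OF g ab(1)] show "g \<in> K"
      using commutator_mem_normal_sym[OF R ab(1)] unfolding K_def R_def by simp
  qed
  have cR: "commutator (commutator a b) g \<in> R" if "g \<in> carrier G" for g
    unfolding R_def using that ab(1,2) by (intro commutator_mem_lcs) auto
  \<comment> \<open>First factor, by the powers of \<open>a\<close> between \<open>lcs 2\<close> and
    \<open>K\<close>: if \<open>a [^] L\<close> were in \<open>lcs 2\<close>, then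
    \<open>[a ^ L, b]\<close>, and with it \<open>[a, b] ^ L\<close>, would lie in
    \<open>R\<close>.\<close>
  have "a \<in> K" using ab(1) commutator_mem_normal_iff[OF R ab(1) ab(1)] by (simp add: K_def)
  moreover have "a [^] L \<notin> lcs (Suc (Suc 0))"
    using commutator_pow_mem_left[OF R ab(1,2) cR[OF ab(1)]] commutator_mem_lcs[OF _ ab(2)] ab(3)
    unfolding R_def by blast
  ultimately have "(k + 1) * card (lcs 2) \<le> card K"
    unfolding numeral_2_eq_2
    using K2 finite_subset[OF _ fin] K_def dvd
    by (intro card_subgroup_ge[of _ _ a L] subK sub) (auto simp del: lower_central.simps)
  \<comment> \<open>Second factor, by the powers of \<open>b\<close> between \<open>K\<close> and
    the group: \<open>b [^] L \<in> K\<close> would put \<open>[a, b ^ L]\<close>, and so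
    \<open>[a, b] ^ L\<close>, into \<open>R\<close>.\<close>
  moreover have "b [^] L \<notin> K"
    using commutator_pow_mem_right[OF R ab(1,2) cR[OF ab(2)]] ab unfolding K_def R_def by blast
  then have "(k + 1) * card K \<le> order G"
    unfolding order_def
    using ab fin K_def dvd by (intro card_subgroup_ge[of _ _ b L] subK subgroup_self) auto
  moreover have "(k + 1) ^ (m - 1) * card (lcs (m + 1)) \<le> card (lcs 2)"
    using chain[of "m - 1"] m by simp
  moreover have "1 \<le> card (lcs (m + 1))"
    using subgroup.one_closed[OF sub[of m]] fin'[of "m + 1"]
    by (auto simp: Suc_le_eq card_gt_0_iff simp del: lower_central.simps)
  ultimately have "(k + 1) * ((k + 1) * ((k + 1) ^ (m - 1) * 1)) \<le> order G"
    by (meson le_trans mult_le_mono2)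
  then show ?thesis using m by (cases m) auto
qed

section \<open>Passing to finite images of a nilpotent subgroup\<close>

lemma (in group) lower_central_mem_subset:
  assumes "subgroup N G"
  shows "lower_central G N i \<subseteq> N"
proof -
  have "lower_central G N (Suc j) \<subseteq> N" for j
  proof (induction j)
    case (Suc j)
    then have "(\<Union>a\<in>lower_central G N (Suc j). \<Union>b\<in>N. {commutator a b}) \<subseteq> N"
      using assms by (auto intro!: subgroup.m_closed subgroup.m_inv_closed)
    then show ?case using generate_subgroup_incl[OF _ assms] by simp
  qed simp
  then show ?thesis by (cases i) auto
qed

lemma (in group_hom) lower_central_image:
  assumes "subgroup N G"
  shows "lower_central H (h ` N) i = h ` lower_central G N i"
proof -
  have "lower_central H (h ` N) (Suc j) = h ` lower_central G N (Suc j)" for j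
  proof (induction j)
    case (Suc j)
    let ?A = "lower_central G N (Suc j)"
    have N: "N \<subseteq> carrier G" using assms subgroup.subset by blast
    then have A: "?A \<subseteq> carrier G" using G.lower_central_mem_subset[OF assms] by blast
    have "H.commutator (h a) (h b) = h (G.commutator a b)" if "a \<in> ?A" "b \<in> N" for a b
    proof -
      have "a \<in> carrier G" "b \<in> carrier G" using that A N by blast+
      then show ?thesis by simp
    qed
    then have "(\<Union>a\<in>h ` ?A. \<Union>b\<in>h ` N. {H.commutator a b})
        = h ` (\<Union>a\<in>?A. \<Union>b\<in>N. {G.commutator a b})"
      unfolding image_UN UN_simps(10) by (intro SUP_cong refl) auto
    moreover have "(\<Union>a\<in>?A. \<Union>b\<in>N. {G.commutator a b}) \<subseteq> carrier G"
      by (intro UN_least) (use A N in \<open>auto simp del: lower_central.simps dest!: subsetD\<close>)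
    ultimately show ?case
      unfolding lower_central.simps(3) Suc.IH using generate_img by simp
  qed simp
  then show ?thesis by (cases i) auto
qed

lemma (in group) lower_central_consistent:
  assumes "subgroup N G"
  shows "lower_central (G\<lparr>carrier := N\<rparr>) N i = lower_central G N i"
proof -
  have "lower_central (G\<lparr>carrier := N\<rparr>) N (Suc j) = lower_central G N (Suc j)" for j
  proof (induction j)
    case (Suc j)
    let ?A = "lower_central G N (Suc j)"
    have A: "?A \<subseteq> N" using lower_central_mem_subset[OF assms] .
    have "(\<Union>a\<in>?A. \<Union>b\<in>N. {a \<otimes> b \<otimes> inv\<^bsub>G\<lparr>carrier := N\<rparr>\<^esub> a \<otimes> inv\<^bsub>G\<lparr>carrier := N\<rparr>\<^esub> b})
        = (\<Union>a\<in>?A. \<Union>b\<in>N. {commutator a b})"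
      using A m_inv_consistent[OF assms] by (intro SUP_cong refl) auto
    moreover have "(\<Union>a\<in>?A. \<Union>b\<in>N. {commutator a b}) \<subseteq> N"
      using A assms by (auto intro!: subgroup.m_closed subgroup.m_inv_closed)
    ultimately show ?case
      using generate_consistent[OF _ assms] by (simp only: lower_central.simps(3) Suc.IH) simp
  qed simp
  then show ?thesis by (cases i) auto
qed

lemma (in group_hom) order_ge_of_lower_central:
  assumes "finite (carrier H)" and N: "subgroup N G"
    and m: "2 \<le> m" "y \<in> lower_central G N m" and c: "1 \<le> c" "lower_central G N c = {\<one>}"
    and y: "h (y [^] (L ^ c :: nat)) \<noteq> \<one>\<^bsub>H\<^esub>" and dvd: "\<And>d. 1 \<le> d \<Longrightarrow> d \<le> k \<Longrightarrow> d dvd L"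
  shows "(k + 1) ^ (m + 1) \<le> order H"
proof -
  define Q where "Q = H\<lparr>carrier := h ` N\<rparr>"
  have sub: "subgroup (h ` N) H" using N by (rule subgroup_img_is_subgroup)
  interpret Q: group Q unfolding Q_def using sub by (rule H.subgroup_imp_group)
  have lcs: "Q.lcs i = h ` lower_central G N i" for i
    unfolding Q_def using H.lower_central_consistent[OF sub] lower_central_image[OF N] by simp
  have hN: "h ` N \<subseteq> carrier H" using sub subgroup.subset by blast
  have "y \<in> carrier G"
    using m(2) G.lower_central_mem_subset[OF N] subgroup.subset[OF N] by blast
  then have "h y [^]\<^bsub>Q\<^esub> (L ^ c) \<noteq> \<one>\<^bsub>Q\<^esub>"
    using y H.nat_pow_consistent[of "h y" "L ^ c" "h ` N"] by (simp add: Q_def hom_nat_pow)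
  moreover have "finite (carrier Q)" using assms(1) hN finite_subset by (auto simp: Q_def)
  moreover have "Q.lcs c = {\<one>\<^bsub>Q\<^esub>}" unfolding lcs c by (simp add: Q_def)
  ultimately have "(k + 1) ^ (m + 1) \<le> order Q"
    using m c(1) dvd by (intro Q.order_ge_of_lcs[of m "h y" c L k]) (auto simp: lcs)
  also have "\<dots> \<le> order H"
    unfolding order_def Q_def using hN assms(1) by (simp add: card_mono)
  finally show ?thesis .
qed

text \<open>The coset count for the whole group over the trivial subgroup.\<close>

lemma (in group_hom) order_ge_of_pow:
  assumes "finite (carrier H)" "y \<in> carrier G"
    and y: "h (y [^] (L::nat)) \<noteq> \<one>\<^bsub>H\<^esub>" and dvd: "\<And>d. 1 \<le> d \<Longrightarrow> d \<le> k \<Longrightarrow> d dvd L"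
  shows "k + 1 \<le> order H"
  using H.card_subgroup_ge[OF H.subgroup_self H.triv_subgroup, of "h y" L k] assms
  by (simp add: order_def hom_nat_pow)

lemma (in group) lower_central_subgroup:
  assumes "subgroup N G"
  shows "subgroup (lower_central G N i) G"
proof -
  have "subgroup (lower_central G N (Suc (Suc j))) G" for j
    using lower_central_mem_subset[OF assms, of "Suc j"] subgroup.subset[OF assms]
    unfolding lower_central.simps(3)
    by (intro generate_is_subgroup UN_least) (auto simp: subset_iff)
  moreover have "subgroup (lower_central G N (Suc 0)) G" using assms by simp
  ultimately show ?thesis using assms
    by (cases i; cases "i - 1") auto
qed

text \<open>A nontrivial element of the intersection is \<open>x\<close> to some nonzero integer
  power; a negative exponent is made positive by taking the inverse.\<close>

lemma (in group) ex_pow_mem_lower_central: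
  assumes x: "x \<in> carrier G" and depth: "has_nilpotent_depth G x m"
  obtains N a c where "subgroup N G" "1 \<le> a" "x [^] (a::nat) \<in> lower_central G N m"
    "1 \<le> c" "lower_central G N c = {\<one>}"
proof -
  obtain N where N: "nilpotent_subgroup G N" "generate G {x} \<inter> lower_central G N m \<noteq> {\<one>}"
    using depth unfolding has_nilpotent_depth_def by blast
  then have subN: "subgroup N G" by (simp add: nilpotent_subgroup_def)
  note sub = lower_central_subgroup[OF subN, of m]
  obtain c where c: "1 \<le> c" "lower_central G N c = {\<one>}"
    using N(1) unfolding nilpotent_subgroup_def by blast
  have "\<one> \<in> generate G {x} \<inter> lower_central G N m"
    using generate.one subgroup.one_closed[OF sub] by blast
  then obtain g where g: "g \<in> generate G {x}" "g \<in> lower_central G N m" "g \<noteq> \<one>"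
    using N(2) by blast
  then obtain z :: int where z: "g = x [^] z" using generate_pow[OF x] by auto
  have "x [^] nat \<bar>z\<bar> \<in> lower_central G N m"
  proof (cases z rule: int_cases2)
    case (nonneg n)
    then have "g = x [^] n" unfolding z by (simp only: int_pow_int)
    then show ?thesis using g(2) nonneg by simp
  next
    case (nonpos n)
    then have "g = inv (x [^] n)" unfolding z by (simp only: int_pow_neg_int x)
    then have "x [^] n = inv g" using x by simp
    then show ?thesis using subgroup.m_inv_closed[OF sub g(2)] nonpos by simp
  qed
  moreover have "1 \<le> nat \<bar>z\<bar>" using g(3) z by (cases "z = 0") auto
  ultimately show thesis using that subN c by blast
qed

section \<open>Word length and residual depth\<close>

lemma (in group) ex_word:
  assumes "S \<subseteq> carrier G" and "w \<in> generate G S"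
  shows "\<exists>ws. set ws \<subseteq> S \<union> m_inv G ` S \<and> foldr (mult G) ws \<one> = w"
  using assms(2)
proof (induction w rule: generate.induct)
  case one
  show ?case by (intro exI[of _ "[]"]) simp
next
  case (incl h)
  then show ?case using assms(1) by (intro exI[of _ "[h]"]) auto
next
  case (inv h)
  then show ?case using assms(1) by (intro exI[of _ "[inv h]"]) auto
next
  case (eng h1 h2)
  then obtain us vs where us: "set us \<subseteq> S \<union> m_inv G ` S" "foldr (mult G) us \<one> = h1"
    and vs: "set vs \<subseteq> S \<union> m_inv G ` S" "foldr (mult G) vs \<one> = h2" by blast
  have h2: "h2 \<in> carrier G" using eng.hyps assms(1) generate_in_carrier by blast
  have "set us \<subseteq> carrier G" using us(1) assms(1) by auto
  \<comment> \<open>Starting the fold at \<open>h2\<close> multiplies the product by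
    \<open>h2\<close> on the right; membership in the carrier is carried along for
    associativity.\<close>
  then have "foldr (mult G) us h2 = foldr (mult G) us \<one> \<otimes> h2
      \<and> foldr (mult G) us \<one> \<in> carrier G"
    using h2 by (induction us) (auto simp: m_assoc)
  then show ?case using us vs by (intro exI[of _ "us @ vs"]) auto
qed

text \<open>The \<open>LEAST\<close> is attained because some word for \<open>w\<close>
  exists.\<close>

lemma (in group) word_of_word_length:
  assumes "S \<subseteq> carrier G" "w \<in> generate G S"
  obtains ws where "set ws \<subseteq> S \<union> m_inv G ` S" "length ws = word_length G S w"
    "foldr (mult G) ws \<one> = w"
proof -
  have "\<exists>k ws. set ws \<subseteq> S \<union> m_inv G ` S \<and> length ws = k \<and> foldr (mult G) ws \<one> = w"
    using ex_word[OF assms] by auto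
  then have "\<exists>ws. set ws \<subseteq> S \<union> m_inv G ` S \<and> length ws = word_length G S w
      \<and> foldr (mult G) ws \<one> = w"
    unfolding word_length_def by (rule LeastI_ex)
  with that show thesis by auto
qed

lemma (in group) finite_word_length_ball:
  assumes "finite S" "S \<subseteq> carrier G" "generate G S = carrier G"
  shows "finite {w \<in> carrier G. word_length G S w \<le> n}"
proof (rule finite_subset)
  let ?A = "S \<union> m_inv G ` S"
  show "finite ((\<lambda>ws. foldr (mult G) ws \<one>) ` {ws. set ws \<subseteq> ?A \<and> length ws \<le> n})"
    using assms(1) by (intro finite_imageI finite_lists_length_le) auto
  show "{w \<in> carrier G. word_length G S w \<le> n}
      \<subseteq> (\<lambda>ws. foldr (mult G) ws \<one>) ` {ws. set ws \<subseteq> ?A \<and> length ws \<le> n}"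
  proof safe
    fix w assume w: "w \<in> carrier G" "word_length G S w \<le> n"
    then obtain ws where "set ws \<subseteq> ?A" "length ws = word_length G S w"
      "foldr (mult G) ws \<one> = w"
      using assms(2,3) by (auto intro: word_of_word_length[of S w])
    then show "w \<in> (\<lambda>ws. foldr (mult G) ws \<one>) ` {ws. set ws \<subseteq> ?A \<and> length ws \<le> n}"
      using w(2) by auto
  qed
qed

lemma (in group) word_length_le_1:
  assumes "S \<subseteq> carrier G" "s \<in> S"
  shows "word_length G S s \<le> 1"
  unfolding word_length_def using assms by (intro Least_le exI[of _ "[s]"]) auto

lemma (in group) word_length_pos:
  assumes "S \<subseteq> carrier G" "w \<in> generate G S" "w \<noteq> \<one>"
  shows "1 \<le> word_length G S w"
proof -
  obtain ws where "length ws = word_length G S w" "foldr (mult G) ws \<one> = w"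
    by (rule word_of_word_length[OF assms(1,2)])
  then show ?thesis using assms(3) by (cases ws) auto
qed

lemma (in group) res_depth_ge:
  assumes "\<And>(H :: nat monoid) \<phi>. \<lbrakk>group H; finite (carrier H); \<phi> \<in> epi G H; \<phi> w \<noteq> \<one>\<^bsub>H\<^esub>\<rbrakk>
    \<Longrightarrow> b \<le> order H"
  shows "enat b \<le> res_depth G w"
  unfolding res_depth_def using assms by (intro Inf_greatest) auto

text \<open>The ball is finite and residual finiteness makes each depth finite, so the
  \<open>Max\<close> is attained, is finite, and is what \<open>the_enat\<close> returns.\<close>

lemma (in group) RF_ge:
  assumes "finite S" "S \<subseteq> carrier G" "generate G S = carrier G" "residually_finite G"
    and w: "w \<in> carrier G - {\<one>}" "word_length G S w \<le> n" "enat b \<le> res_depth G w"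
  shows "b \<le> RF G S n"
proof -
  let ?B = "{w \<in> carrier G - {\<one>}. word_length G S w \<le> n}"
  have fin: "finite (res_depth G ` ?B)"
    by (intro finite_imageI finite_subset[OF _ finite_word_length_ball[OF assms(1-3)]]) auto
  have wB: "w \<in> ?B" using w by simp
  then have "Max (res_depth G ` ?B) \<in> res_depth G ` ?B" using fin by (intro Max_in) auto
  then have "Max (res_depth G ` ?B) < \<infinity>"
    using assms(4) by (force simp: residually_finite_def)
  then have "Max (res_depth G ` ?B) = enat (RF G S n)" unfolding RF_def by auto
  moreover have "enat b \<le> Max (res_depth G ` ?B)"
    using w(3) wB fin by (intro order_trans[OF w(3)] Max_ge) auto
  ultimately show ?thesis by simp
qed

lemma (in group) RF_ge_1_mono:
  assumes "finite S" "S \<subseteq> carrier G" "generate G S = carrier G" "residually_finite G"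
    and "carrier G \<noteq> {\<one>}" "1 \<le> n" "n \<le> n'"
  shows "1 \<le> RF G S n" "RF G S n \<le> RF G S n'"
proof -
  \<comment> \<open>A nontrivial generator lies in every ball of radius at least 1, so no
    \<open>Max\<close> is over an empty set.\<close>
  have "\<not> S \<subseteq> {\<one>}" using assms(3,5) mono_generate[of S "{\<one>}"] generate_one
    by (metis insert_subset one_closed subset_antisym empty_subsetI)
  then obtain s where s: "s \<in> S" "s \<noteq> \<one>" by auto
  let ?B = "\<lambda>n. {w \<in> carrier G - {\<one>}. word_length G S w \<le> n}"
  have "enat 1 \<le> res_depth G s"
    by (rule res_depth_ge)
      (simp add: Suc_le_eq monoid.order_gt_0_iff_finite group.is_monoid)
  then show "1 \<le> RF G S n"
    using s word_length_le_1[OF assms(2) s(1)] assms(2,6)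
    by (intro RF_ge[OF assms(1-4), of s]) auto
  have fin: "finite (res_depth G ` ?B n)"
    by (intro finite_imageI finite_subset[OF _ finite_word_length_ball[OF assms(1-3)]]) auto
  have "s \<in> ?B n" using s word_length_le_1[OF assms(2) s(1)] assms(2,6) by auto
  then have "?B n \<noteq> {}" by blast
  then have "Max (res_depth G ` ?B n) \<in> res_depth G ` ?B n" using fin by (intro Max_in) auto
  then obtain w where w: "w \<in> ?B n" "Max (res_depth G ` ?B n) = res_depth G w" by auto
  have "res_depth G w < \<infinity>" using assms(4) w(1) unfolding residually_finite_def by blast
  then have "res_depth G w = enat (RF G S n)" unfolding RF_def w(2) by auto
  then show "RF G S n \<le> RF G S n'"
    using w(1) assms(7) by (intro RF_ge[OF assms(1-4), of w]) auto
qed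

section \<open>Growth\<close>

lemma preceqI:
  fixes M :: real
  assumes B: "1 \<le> B" and le: "\<And>n. 1 \<le> n \<Longrightarrow> F n \<le> M * g (B * n)"
    and mono: "\<And>m n. 1 \<le> m \<Longrightarrow> m \<le> n \<Longrightarrow> g m \<le> g n" and nonneg: "\<And>n. 1 \<le> n \<Longrightarrow> 0 \<le> g n"
  shows "F \<preceq> g"
proof -
  \<comment> \<open>One integer must serve both as factor and as scale of the argument:
    \<open>K\<close> is at least \<open>M\<close> and a positive multiple of
    \<open>B\<close>.\<close>
  define K where "K = (nat \<lceil>M\<rceil> + 1) * B"
  have "M \<le> real (nat \<lceil>M\<rceil> + 1)" by linarith
  also have "\<dots> \<le> real K" unfolding K_def using B mult_le_mono2[of 1 B "nat \<lceil>M\<rceil> + 1"]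
    by (intro of_nat_mono) simp
  finally have M: "M \<le> real K" .
  have "F n \<le> real K * g (K * n)" if n: "1 \<le> n" for n
  proof -
    have Bn: "1 \<le> B * n" using B n by simp
    have "F n \<le> M * g (B * n)" using le n .
    also have "\<dots> \<le> real K * g (B * n)" using M nonneg[OF Bn] by (rule mult_right_mono)
    also have "\<dots> \<le> real K * g (K * n)"
      using mono[OF Bn, of "K * n"] by (intro mult_left_mono) (auto simp: K_def)
    finally show ?thesis .
  qed
  moreover have "K > 0" using B by (simp add: K_def)
  ultimately show ?thesis unfolding preceq_def by blast
qed

text \<open>Taking logarithms in \<open>2 ^ n \<le> C * f (C * n)\<close> bounds \<open>n\<close>
  linearly in \<open>ln (f (C * n))\<close>. The additive constant is absorbed by
  \<open>max 1 z\<close>, which is harmless since \<open>g\<close> is at least 1.\<close>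

lemma power_preceq_if_ln_power_preceq:
  fixes f :: "nat \<Rightarrow> real"
  assumes f1: "\<And>n. 1 \<le> n \<Longrightarrow> 1 \<le> f n" and pow2: "(\<lambda>n. 2 ^ n) \<preceq> f"
    and ln: "(\<lambda>n. ln (f n) ^ r) \<preceq> g"
    and mono: "\<And>m n. 1 \<le> m \<Longrightarrow> m \<le> n \<Longrightarrow> g m \<le> g n" and ge1: "\<And>n. 1 \<le> n \<Longrightarrow> 1 \<le> g n"
  shows "(\<lambda>n. real n ^ r) \<preceq> g"
proof -
  obtain C :: nat where C: "C > 0" "\<And>n. 1 \<le> n \<Longrightarrow> 2 ^ n \<le> real C * f (C * n)"
    using pow2 unfolding preceq_def by auto
  obtain C' :: nat where C': "C' > 0" "\<And>n. 1 \<le> n \<Longrightarrow> ln (f n) ^ r \<le> real C' * g (C' * n)"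
    using ln unfolding preceq_def by auto
  \<comment> \<open>From \<open>1 / 2 \<le> ln 2\<close> follows
    \<open>n \<le> 2 * ln C + 2 * z\<close>, and this is at most \<open>E * max 1 z\<close>.\<close>
  define E where "E = 2 * (ln (real C) + 1)"
  have lnC: "0 \<le> ln (real C)" using C by simp
  have "real n ^ r \<le> (E ^ r * real C') * g (C' * C * n)" if n: "1 \<le> n" for n
  proof -
    define z where "z = ln (f (C * n))"
    have fn: "1 \<le> f (C * n)" using C n by (intro f1) simp
    then have z: "0 \<le> z" by (simp add: z_def)
    have "real n * ln 2 = ln (2 ^ n)" by (simp add: ln_realpow)
    also have "\<dots> \<le> ln (real C * f (C * n))" using C fn n by (intro ln_mono) auto
    also have "\<dots> = ln (real C) + z" using C fn by (simp add: ln_mult z_def)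
    finally have "real n * ln 2 \<le> ln (real C) + z" .
    moreover have "1 / 2 \<le> ln (2 :: real)" using ln_le_minus_one[of "1 / 2"] by (simp add: ln_div)
    then have "real n * (1 / 2) \<le> real n * ln 2" by (intro mult_left_mono) auto
    ultimately have "real n \<le> 2 * ln (real C) * 1 + 2 * z" by simp
    also have "\<dots> \<le> 2 * ln (real C) * max 1 z + 2 * max 1 z"
      using lnC by (intro add_mono mult_left_mono) auto
    also have "\<dots> = E * max 1 z" by (simp add: E_def algebra_simps)
    finally have "real n ^ r \<le> (E * max 1 z) ^ r" by (intro power_mono) auto
    also have "\<dots> = E ^ r * max 1 z ^ r" by (simp add: power_mult_distrib)
    also have "max 1 z ^ r \<le> real C' * g (C' * (C * n))"
    proof (cases "z \<le> 1")
      case True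
      have "1 * 1 \<le> real C' * g (C' * (C * n))"
        using C(1) C'(1) n by (intro mult_mono ge1) auto
      then show ?thesis using True by (simp add: max_def)
    next
      case False
      then show ?thesis using C'(2)[of "C * n"] C n by (simp add: z_def max_def)
    qed
    finally show ?thesis using lnC by (simp add: E_def mult_ac mult_left_mono)
  qed
  then show ?thesis
    using C(1) C'(1) mono order_trans[OF zero_le_one ge1]
    by (intro preceqI[where B = "C' * C" and M = "E ^ r * real C'"]) auto
qed

text \<open>An infinite set has \<open>card\<close> 0, so \<open>ord x = 0\<close>, which divides no
  positive \<open>n\<close>.\<close>

lemma (in group) pow_neq_one_if_infinite_generate:
  assumes "x \<in> carrier G" "infinite (generate G {x})" "0 < (n::nat)"
  shows "x [^] n \<noteq> \<one>"
  using generate_pow_card[OF assms(1)] pow_eq_id[OF assms(1)] assms(2,3) by simp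

text \<open>Covers both bounds: \<open>r = a = c = 1\<close> in general, and
  \<open>r = m + 1\<close> for depth \<open>m\<close>. Distortion bounds \<open>f\<close> at the
  length of the test element; monotonicity turns this into a bound on the length itself.\<close>

lemma (in group) ln_power_preceq_RF:
  fixes f :: "nat \<Rightarrow> nat"
  assumes S: "finite S" "S \<subseteq> carrier G" "generate G S = carrier G" "residually_finite G"
    and f1: "\<And>n. 1 \<le> n \<Longrightarrow> 1 \<le> f n" and mono: "mono_on {1..} f"
    and x: "x \<in> carrier G" "infinite (generate G {x})" "strictly_distorted G S f x"
    and a: "1 \<le> a" and c: "1 \<le> c"
    and depth: "\<And>k. enat ((k + 1) ^ r) \<le> res_depth G (x [^] (a * Lcm {1..k} ^ c))"
  shows "(\<lambda>n. ln (real (f n)) ^ r) \<preceq> (\<lambda>n. real (RF G S n))"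
proof -
  have nontriv: "carrier G \<noteq> {\<one>}"
    using pow_neq_one_if_infinite_generate[OF x(1,2), of 1] x(1) by auto
  note RF = RF_ge_1_mono[OF S nontriv]
  obtain C2 :: real where C2: "C2 > 0"
    "\<And>n. 0 < n \<Longrightarrow> real (f (word_length G S (x [^] (n::nat)))) \<le> C2 * real n"
    using x(3) unfolding strictly_distorted_def by auto
  \<comment> \<open>The value of \<open>f\<close> at the length of \<open>w\<close> will be at most
    \<open>exp (A - 1 + D * k)\<close>. The summand 1 in \<open>A\<close> makes the later comparison
    with \<open>f n\<close> strict, as excluding lengths above \<open>n\<close> requires.\<close>
  define A where "A = \<bar>ln (C2 * real a)\<bar> + 1"
  define D where "D = real c * ln 16"
  have A: "0 < A" unfolding A_def by linarith
  have D: "0 < D" unfolding D_def using c by simp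
  have "ln (real (f n)) ^ r \<le> (A + D) ^ r * real (RF G S (1 * n))" if n: "1 \<le> n" for n
  proof (cases "ln (real (f n)) \<le> A")
    \<comment> \<open>For small \<open>f n\<close> the trivial bound \<open>1 \<le> RF G S n\<close>
      is enough.\<close>
    case True
    have "ln (real (f n)) ^ r \<le> (A + D) ^ r"
      using True D f1[OF n] by (intro power_mono) auto
    moreover have "(A + D) ^ r * 1 \<le> (A + D) ^ r * real (RF G S (1 * n))"
      using RF(1)[OF n, of n] A D by (intro mult_left_mono) auto
    ultimately show ?thesis by linarith
  next
    case False
    define y where "y = ln (real (f n))"
    \<comment> \<open>\<open>k\<close> is as large as possible, up to a constant summand, such that the bound
      \<open>C2 * a * 16 ^ (c * k)\<close> on \<open>f\<close> at the length of \<open>w\<close> stays below \<open>f n\<close>.\<close>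
    define k where "k = nat \<lfloor>(y - A) / D\<rfloor>"
    have "0 \<le> (y - A) / D" using False D by (simp add: y_def)
    then have "real k \<le> (y - A) / D" "(y - A) / D \<le> real k + 1"
      unfolding k_def by linarith+
    then have k: "D * real k \<le> y - A" "y - A \<le> D * (real k + 1)"
      using D by (simp_all add: field_simps)
    define l where "l = (Lcm {1..k} :: nat)"
    have l: "0 < l" "real l \<le> 16 ^ k"
      unfolding l_def using Lcm_atLeastAtMost_pos[of k] of_nat_mono[OF Lcm_le_power[of k], where 'a = real]
      by simp_all
    define w where "w = x [^] (a * l ^ c)"
    have al: "0 < a * l ^ c" using a l by simp
    have w: "w \<in> carrier G - {\<one>}"
      using pow_neq_one_if_infinite_generate[OF x(1,2) al] x(1) by (simp add: w_def)
    have "real (f (word_length G S w)) \<le> C2 * real (a * l ^ c)" unfolding w_def by (rule C2(2)[OF al])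
    also have "\<dots> = (C2 * real a) * real l ^ c" by simp
    also have "\<dots> \<le> exp (A - 1) * exp (D * real k)"
    proof (rule mult_mono)
      have "C2 * real a = exp (ln (C2 * real a))" using C2 a by simp
      also have "\<dots> \<le> exp (A - 1)" unfolding A_def by simp
      finally show "C2 * real a \<le> exp (A - 1)" .
      have "real l ^ c \<le> (16 ^ k) ^ c" using l by (intro power_mono) auto
      also have "\<dots> = exp (ln 16) ^ (k * c)" by (simp add: power_mult)
      also have "\<dots> = exp (D * real k)"
        unfolding D_def exp_of_nat_mult[symmetric] by (simp add: mult_ac)
      finally show "real l ^ c \<le> exp (D * real k)" .
    qed (use C2 a in auto)
    also have "\<dots> \<le> exp (y - 1)" using k by (simp add: exp_add[symmetric])
    also have "\<dots> < exp y" by simp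
    also have "\<dots> = real (f n)" using f1[OF n] by (simp add: y_def)
    finally have "f (word_length G S w) < f n" by simp
    moreover have "1 \<le> word_length G S w" using w S by (intro word_length_pos) auto
    ultimately have "word_length G S w \<le> n"
      using mono_onD[OF mono, of n "word_length G S w"] n by fastforce
    then have RFn: "(k + 1) ^ r \<le> RF G S n"
      using depth[of k] w by (intro RF_ge[OF S, of w]) (auto simp: w_def l_def)
    \<comment> \<open>Maximality of \<open>k\<close> makes \<open>k + 1\<close> at least a constant
      multiple of \<open>ln (f n)\<close>.\<close>
    have "y \<le> A * 1 + D * (real k + 1)" using k by simp
    also have "\<dots> \<le> A * (real k + 1) + D * (real k + 1)"
      using A D by (intro add_mono mult_left_mono) auto
    finally have "y \<le> (A + D) * real (k + 1)" by (simp add: algebra_simps)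
    then have "y ^ r \<le> ((A + D) * real (k + 1)) ^ r"
      using False A by (intro power_mono) (auto simp: y_def)
    also have "\<dots> = (A + D) ^ r * real ((k + 1) ^ r)" by (simp add: power_mult_distrib)
    also have "\<dots> \<le> (A + D) ^ r * real (RF G S n)"
      using RFn A D by (intro mult_left_mono of_nat_mono) auto
    finally show ?thesis by (simp add: y_def)
  qed
  then show ?thesis
    using RF by (intro preceqI[where B = 1 and M = "(A + D) ^ r"]) auto
qed

theorem theorem1p1:
  fixes G :: "('a, 'b) monoid_scheme" and S :: "'a set" and f :: "nat \<Rightarrow> nat" and x :: 'a
  assumes "group G"
    and "finite S" and "S \<subseteq> carrier G" and "generate G S = carrier G"
    and "residually_finite G"
    and "solvable G"
    and "\<not> virtually_nilpotent G"
    and "\<And>n. n \<ge> 1 \<Longrightarrow> f n \<ge> 1"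
    and "mono_on {1..} f"
    and "(\<lambda>n. 2 ^ n) \<preceq> (\<lambda>n. real (f n))"
    and "(\<lambda>n. real (f n)) \<preceq> (\<lambda>n. 2 ^ (2 ^ n))"
    and "x \<in> fitting G"
    and "infinite (generate G {x})"
    and "strictly_distorted G S f x"
  shows "((\<lambda>n. ln (real (f n))) \<preceq> (\<lambda>n. real (RF G S n)))
    \<and> (\<forall>m>1. has_nilpotent_depth G x m \<longrightarrow>
          (\<lambda>n. ln (real (f n)) ^ (m + 1)) \<preceq> (\<lambda>n. real (RF G S n)))
    \<and> ((\<lambda>n. real n) \<preceq> (\<lambda>n. real (RF G S n)))
    \<and> (\<forall>m>1. has_nilpotent_depth G x m \<longrightarrow>
          (\<lambda>n. real n ^ (m + 1)) \<preceq> (\<lambda>n. real (RF G S n)))"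
proof -
  interpret group G by fact
  note S = assms(2-5)
  have "(\<Union>{N. N \<lhd> G \<and> nilpotent_subgroup G N}) \<subseteq> carrier G"
    by (auto simp: nilpotent_subgroup_def dest: subgroup.subset)
  then have x: "x \<in> carrier G"
    using assms(12) generate_in_carrier unfolding fitting_def by blast
  have nontriv: "carrier G \<noteq> {\<one>\<^bsub>G\<^esub>}"
    using pow_neq_one_if_infinite_generate[OF x assms(13), of 1] x by auto
  note RF = RF_ge_1_mono[OF S nontriv]
  have epi: "group_hom G H \<phi>" if "group H" "\<phi> \<in> epi G H" for H :: "nat monoid" and \<phi>
    using that is_group by (simp add: group_hom_def group_hom_axioms_def epi_def)
  \<comment> \<open>The trivial exponents and factor match the case
    \<open>r = a = c = 1\<close>.\<close>
  have "enat ((k + 1) ^ 1) \<le> res_depth G (x [^]\<^bsub>G\<^esub> (1 * Lcm {1..k} ^ 1 :: nat))" for k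
  proof (rule res_depth_ge)
    fix H :: "nat monoid" and \<phi>
    assume "group H" "finite (carrier H)" "\<phi> \<in> epi G H"
      "\<phi> (x [^]\<^bsub>G\<^esub> (1 * Lcm {1..k} ^ 1 :: nat)) \<noteq> \<one>\<^bsub>H\<^esub>"
    then show "(k + 1) ^ 1 \<le> order H"
      using group_hom.order_ge_of_pow[OF epi, of H \<phi> x "Lcm {1..k}" k] x by (simp add: dvd_Lcm)
  qed
  then have ln1: "(\<lambda>n. ln (real (f n)) ^ 1) \<preceq> (\<lambda>n. real (RF G S n))"
    using assms x by (intro ln_power_preceq_RF[where a = 1 and c = 1]) auto
  have lnm: "(\<lambda>n. ln (real (f n)) ^ (m + 1)) \<preceq> (\<lambda>n. real (RF G S n))"
    if m: "m > 1" "has_nilpotent_depth G x m" for m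
  proof -
    obtain N a c where N: "subgroup N G" and a: "1 \<le> a" "x [^]\<^bsub>G\<^esub> (a::nat) \<in> lower_central G N m"
      and c: "1 \<le> c" "lower_central G N c = {\<one>\<^bsub>G\<^esub>}"
      using ex_pow_mem_lower_central[OF x m(2)] by metis
    \<comment> \<open>This is the test element \<open>y ^ (L ^ c)\<close> with
      \<open>y = x ^ a\<close>.\<close>
    have "enat ((k + 1) ^ (m + 1)) \<le> res_depth G (x [^]\<^bsub>G\<^esub> (a * Lcm {1..k} ^ c))" for k
    proof (rule res_depth_ge)
      fix H :: "nat monoid" and \<phi>
      assume "group H" "finite (carrier H)" "\<phi> \<in> epi G H"
        "\<phi> (x [^]\<^bsub>G\<^esub> (a * Lcm {1..k} ^ c)) \<noteq> \<one>\<^bsub>H\<^esub>"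
      then show "(k + 1) ^ (m + 1) \<le> order H"
        using m(1) x
        by (intro group_hom.order_ge_of_lower_central[OF epi _ N _ a(2) c, of H \<phi> "Lcm {1..k}"])
          (auto simp: nat_pow_pow dvd_Lcm)
    qed
    then show ?thesis
      using assms x a(1) c(1) by (intro ln_power_preceq_RF[where a = a and c = c]) auto
  qed
  have pow: "(\<lambda>n. real n ^ r) \<preceq> (\<lambda>n. real (RF G S n))"
    if "(\<lambda>n. ln (real (f n)) ^ r) \<preceq> (\<lambda>n. real (RF G S n))" for r
    using assms(8,10) RF that
    by (intro power_preceq_if_ln_power_preceq[where f = "\<lambda>n. real (f n)"]) auto
  show ?thesis using ln1 pow[OF ln1] lnm pow[OF lnm] by auto
qed

end
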